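(* Let $k\ge1$ be an integer. Then the following four expressions are equal as formal power series in $q$: $$\sum_{n=0}^{\infty}\frac{q^{k\cdot n+2k\cdot(n-1)+2k\cdot(n-2)+\cdots+2k\cdot 1}}{(1-q)(1-q^2)\cdots(1-q^n)}\prod_{j=n+1}^{\infty}\left(1+q^j+q^{2j}+\cdots+q^{(k-1)j}\right)$$ $$=\prod_{j=1}^{\infty}\frac{1-q^{jk}}{1-q^j}\cdot\sum_{n=0}^{\infty}\frac{q^{kn^2}}{(1-q^k)(1-q^{2k})\cdots(1-q^{nk})}$$ $$=\prod_{j=1}^{\infty}\frac{1-q^{jk}}{1-q^j}\cdot\prod_{n=1}^{\infty}\frac{1}{(1-q^{k(5n-4)})(1-q^{k(5n-1)})}$$ $$=\prod_{j=1}^{\infty}\frac{(1-q^{5kj})(1-q^{k(5j-2)})(1-q^{k(5j-3)})}{1-q^j}.$$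
   Context: Empty products equal $1$. In the first sum the exponent is $kn+2k\sum_{i=1}^{n-1} i$, which is $0$ for $n=0$ and $k$ for $n=1$. *)

theory Defs
  imports "HOL-Analysis.Infinite_Products" "HOL-Computational_Algebra.Formal_Power_Series"
begin

(* The metric-space instance of the type fps is the X-adic topology; infinite sums and
   products of formal power series (suminf, prodinf) refer to it. *)

abbreviation q :: "'a::field fps" where "q \<equiv> fps_X"

end

(* With p = q^k, each factor 1 + q^j + ... + q^((k-1)j) is (1 - q^(jk)) / (1 - q^j); pulling these
   factors out of the first sum turns it into the product D of all of them times the
   Rogers-Ramanujan sum S in the variable p, because the exponent is k n^2. So the theorem
   reduces to the first Rogers-Ramanujan identity for p, together with a regrouping of
   prod (1 - p^j) by the residue of j modulo 5.

   The identity is obtained by the Bailey chain. The q-Vandermonde sum shows that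
   alpha_m -> p^(m^2) alpha_m transforms beta_N = sum_m alpha_m / ((p)_(N-m) (p)_(N+m)) into
   beta'_N = sum_s p^(s^2) beta_s / (p)_(N-s). Two steps starting from the unit pair
   alpha_m = (-1)^m p^(m(m-1)/2), beta_N = [N = 0], give
   sum_s p^(s^2) / ((p)_(N-s) (p)_s) = sum_m (-1)^m p^(m(5m-1)/2) / ((p)_(N-m) (p)_(N+m)).
   The finite Jacobi triple product in base p^5 evaluates the same alternating sum with
   denominators (p^5)_(N-m) (p^5)_(N+m). Both denominators become independent of m in the
   limit, so comparing the two limits eliminates the theta series. *)
theory Submission
  imports Defs
begin

unbundle fps_syntax and no vec_syntax

section \<open>Convergence in the X-adic topology\<close>

lemma fps_X_power_dvd_iff: "fps_X ^ n dvd (f :: 'a::field fps) \<longleftrightarrow> (\<forall>i<n. f $ i = 0)"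
proof (cases "f = 0")
  case False
  then have "fps_X ^ n dvd f \<longleftrightarrow> n \<le> subdegree f"
    by (simp add: fps_dvd_iff)
  also have "\<dots> \<longleftrightarrow> (\<forall>i<n. f $ i = 0)"
    using False by (metis less_le_trans linorder_not_le nth_less_subdegree_zero nth_subdegree_nonzero)
  finally show ?thesis .
qed simp

text \<open>Turns X-adic convergence into eventual divisibility, so that error estimates become
  calculations with \<open>dvd\<close>.\<close>

lemma tendsto_fps_iff_dvd:
  fixes L :: "'a::field fps"
  shows "(f \<longlongrightarrow> L) F \<longleftrightarrow> (\<forall>n. eventually (\<lambda>x. q ^ n dvd f x - L) F)"
proof
  assume L: "(f \<longlongrightarrow> L) F"
  show "\<forall>n. eventually (\<lambda>x. q ^ n dvd f x - L) F"
  proof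
    fix n
    have "eventually (\<lambda>x. \<forall>i\<in>{..<n}. f x $ i = L $ i) F"
      using L by (subst eventually_ball_finite_distrib) (auto simp: tendsto_fps_iff)
    then show "eventually (\<lambda>x. q ^ n dvd f x - L) F"
      by eventually_elim (simp add: fps_X_power_dvd_iff)
  qed
next
  assume R: "\<forall>n. eventually (\<lambda>x. q ^ n dvd f x - L) F"
  show "(f \<longlongrightarrow> L) F"
    unfolding tendsto_fps_iff
  proof
    fix n
    \<comment> \<open>Divisibility by \<open>q ^ n\<close> controls only the coefficients below
      \<open>n\<close>, hence the exponent \<open>Suc n\<close>.\<close>
    from R have "eventually (\<lambda>x. q ^ Suc n dvd f x - L) F" by blast
    then show "eventually (\<lambda>x. f x $ n = L $ n) F"
      by eventually_elim (auto simp: fps_X_power_dvd_iff simp del: power_Suc)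
  qed
qed

text \<open>Each coefficient of a sum or a negative depends on the same coefficient of the arguments
  only, and coefficients are locally constant.\<close>

instance fps :: (field) topological_ab_group_add
proof
  fix a b :: "'a fps"
  show "((\<lambda>x. fst x + snd x) \<longlongrightarrow> a + b) (nhds a \<times>\<^sub>F nhds b)"
    unfolding tendsto_fps_iff
  proof
    fix n
    have "eventually (\<lambda>x. fst x $ n = a $ n \<and> snd x $ n = b $ n) (nhds a \<times>\<^sub>F nhds b)"
      by (intro eventually_prodI eventually_fps_nth_eq_nhds_fps)
    then show "eventually (\<lambda>x. (fst x + snd x) $ n = (a + b) $ n) (nhds a \<times>\<^sub>F nhds b)"
      by eventually_elim simp
  qed
  show "(uminus \<longlongrightarrow> - a) (nhds a)"
    unfolding tendsto_fps_iff using eventually_fps_nth_eq_nhds_fps[of _ a] by simp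
qed

text \<open>Coefficient \<open>n\<close> of a product depends only on the coefficients up to
  \<open>n\<close> of the factors, and these are locally constant.\<close>

instance fps :: (field) topological_semigroup_mult
proof
  fix a b :: "'a fps"
  show "((\<lambda>x. fst x * snd x) \<longlongrightarrow> a * b) (nhds a \<times>\<^sub>F nhds b)"
    unfolding tendsto_fps_iff
  proof
    fix n
    have "eventually (\<lambda>x. (\<forall>i\<le>n. fst x $ i = a $ i) \<and> (\<forall>i\<le>n. snd x $ i = b $ i)) (nhds a \<times>\<^sub>F nhds b)"
      by (intro eventually_prodI eventually_fps_nth_eq_nhds_fps_strong)
    then show "eventually (\<lambda>x. (fst x * snd x) $ n = (a * b) $ n) (nhds a \<times>\<^sub>F nhds b)"
      by eventually_elim (simp add: fps_mult_nth)
  qed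
qed

text \<open>Coefficient \<open>i\<close> no longer changes from index \<open>i + 1\<close> on, so
  the limit is read off along a diagonal. The second conjunct keeps the rate of convergence.\<close>

lemma fps_telescope_tendsto:
  fixes x :: "nat \<Rightarrow> 'a::field fps"
  assumes "\<And>n. q ^ n dvd x (Suc n) - x n"
  shows "\<exists>L. x \<longlonglongrightarrow> L \<and> (\<forall>n. q ^ n dvd L - x n)"
proof -
  have diff: "q ^ m dvd x N - x m" if "m \<le> N" for m N
    using that
  proof (induction N rule: dec_induct)
    case (step N)
    have "q ^ m dvd x (Suc N) - x N"
      using assms[of N] step.hyps(1) by (meson dvd_trans le_imp_power_dvd)
    from dvd_add[OF this step.IH] show ?case by simp
  qed simp
  define L where "L = Abs_fps (\<lambda>i. x (Suc i) $ i)"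
  have nth: "x N $ i = L $ i" if "i < N" for i N
    using diff[of "Suc i" N] that by (simp add: L_def fps_X_power_dvd_iff del: power_Suc)
  have dvd: "q ^ n dvd L - x n" for n
    by (simp add: fps_X_power_dvd_iff nth)
  have "x \<longlonglongrightarrow> L"
    unfolding tendsto_fps_iff
  proof
    fix i
    show "eventually (\<lambda>N. x N $ i = L $ i) sequentially"
      using eventually_gt_at_top[of i] by eventually_elim (rule nth)
  qed
  then show ?thesis using dvd by blast
qed

lemma fps_summableI:
  fixes a :: "nat \<Rightarrow> 'a::field fps"
  assumes "\<And>n. q ^ n dvd a n"
  shows "summable a"
proof -
  have "\<exists>L. (\<lambda>n. \<Sum>i<n. a i) \<longlonglongrightarrow> L"
    using fps_telescope_tendsto[of "\<lambda>n. \<Sum>i<n. a i"] assms by auto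
  then show ?thesis by (auto simp: summable_def sums_def)
qed

text \<open>Under this condition the partial products stabilise, and the limit has constant coefficient 1, so the
  exclusion of the limit 0 in the definition of a convergent product is harmless.\<close>

definition one_mod_powers :: "(nat \<Rightarrow> 'a::field fps) \<Rightarrow> bool" where
  "one_mod_powers u \<longleftrightarrow> (\<forall>j. q ^ Suc j dvd u j - 1)"

lemma one_mod_powers_nth_0: "one_mod_powers u \<Longrightarrow> u j $ 0 = 1"
proof -
  assume "one_mod_powers u"
  then have "q ^ Suc j dvd u j - 1" by (simp add: one_mod_powers_def)
  then show ?thesis unfolding fps_X_power_dvd_iff by auto
qed

text \<open>The factor \<open>u n\<close> changes the partial product by a multiple of
  \<open>q ^ n\<close>, so the partial products telescope.\<close>

lemma one_mod_powers_limit: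
  assumes "one_mod_powers u"
  obtains L where "(\<lambda>n. \<Prod>j<n. u j) \<longlonglongrightarrow> L" "L $ 0 = 1" "\<forall>n. q ^ n dvd L - (\<Prod>j<n. u j)"
    "prodinf u = L" "convergent_prod u"
proof -
  have "q ^ n dvd (\<Prod>j<Suc n. u j) - (\<Prod>j<n. u j)" for n
  proof -
    have "(\<Prod>j<Suc n. u j) - (\<Prod>j<n. u j) = (\<Prod>j<n. u j) * (u n - 1)"
      by (simp add: algebra_simps)
    moreover have "q ^ n dvd u n - 1"
      using assms unfolding one_mod_powers_def by (metis dvd_mult_right power_Suc)
    ultimately show ?thesis by simp
  qed
  from fps_telescope_tendsto[of "\<lambda>n. \<Prod>j<n. u j", OF this]
  obtain L where L: "(\<lambda>n. \<Prod>j<n. u j) \<longlonglongrightarrow> L" "\<forall>n. q ^ n dvd L - (\<Prod>j<n. u j)"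
    by blast
  \<comment> \<open>The rate at \<open>n = 1\<close> compares \<open>L\<close> with the single
    factor \<open>u 0\<close> and transfers its constant coefficient 1.\<close>
  have "q ^ 1 dvd L - (\<Prod>j<1. u j)" using L(2) by blast
  then have L0: "L $ 0 = 1"
    unfolding fps_X_power_dvd_iff using one_mod_powers_nth_0[OF assms, of 0] by (simp add: lessThan_Suc)
  then have nz: "L \<noteq> 0" by auto
  have lim: "(\<lambda>n. \<Prod>j\<le>n. u j) \<longlonglongrightarrow> L"
    using L(1) LIMSEQ_lessThan_iff_atMost by blast
  have "prodinf u = L"
    using lim nz by (rule prodinf_eq_prod_lim)
  moreover have "convergent_prod u"
  proof -
    have "raw_has_prod u 0 L" using lim nz by (simp add: raw_has_prod_def)
    then show ?thesis unfolding convergent_prod_def by blast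
  qed
  ultimately show ?thesis by (intro that[OF L(1) L0 L(2)])
qed

lemma one_mod_powers_mult:
  assumes "one_mod_powers u" "one_mod_powers v"
  shows "one_mod_powers (\<lambda>j. u j * v j)"
  unfolding one_mod_powers_def
proof
  fix j
  have "u j * v j - 1 = u j * (v j - 1) + (u j - 1)" by (simp add: algebra_simps)
  then show "q ^ Suc j dvd u j * v j - 1"
    using assms unfolding one_mod_powers_def by (metis dvd_add dvd_mult)
qed

lemma one_mod_powers_inverse:
  assumes "one_mod_powers u"
  shows "one_mod_powers (\<lambda>j. inverse (u j))"
  unfolding one_mod_powers_def
proof
  fix j
  have "inverse (u j) * u j = 1"
    using one_mod_powers_nth_0[OF assms] by (simp add: inverse_mult_eq_1)
  then have "inverse (u j) - 1 = - inverse (u j) * (u j - 1)" by (simp add: algebra_simps)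
  then show "q ^ Suc j dvd inverse (u j) - 1"
    using assms unfolding one_mod_powers_def by (metis dvd_mult)
qed

lemma one_mod_powers_divide:
  assumes "one_mod_powers u" "one_mod_powers v"
  shows "one_mod_powers (\<lambda>j. u j / v j)"
proof -
  have "u j / v j = u j * inverse (v j)" for j
    using one_mod_powers_nth_0[OF assms(2)] by (simp add: fps_divide_unit)
  then show ?thesis
    using one_mod_powers_mult[OF assms(1) one_mod_powers_inverse[OF assms(2)]] by simp
qed

lemma prodinf_one_mod_powers_mult:
  assumes "one_mod_powers u" "one_mod_powers v"
  shows "(\<Prod>j. u j * v j) = prodinf u * prodinf v"
proof -
  obtain L M where L: "(\<lambda>n. \<Prod>j<n. u j) \<longlonglongrightarrow> L" "L $ 0 = 1" "prodinf u = L"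
    and M: "(\<lambda>n. \<Prod>j<n. v j) \<longlonglongrightarrow> M" "M $ 0 = 1" "prodinf v = M"
    by (metis one_mod_powers_limit[OF assms(1)] one_mod_powers_limit[OF assms(2)])
  have "(\<lambda>n. \<Prod>j<n. u j * v j) \<longlonglongrightarrow> L * M"
    using tendsto_mult[OF L(1) M(1)] by (simp add: prod.distrib)
  moreover have "L * M \<noteq> 0" using L(2) M(2) by auto
  ultimately show ?thesis
    using prodinf_eq_prod_lim' L(3) M(3) by blast
qed

lemma prodinf_one_mod_powers_inverse:
  fixes u :: "nat \<Rightarrow> 'a::field fps"
  assumes u: "one_mod_powers u"
  shows "(\<Prod>j. inverse (u j)) * prodinf u = 1"
proof -
  have "inverse (u j) * u j = 1" for j
    using one_mod_powers_nth_0[OF u, of j] by (simp add: inverse_mult_eq_1)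
  then have "(\<lambda>j. inverse (u j) * u j) = (\<lambda>j. 1)" by (rule ext)
  moreover have "(\<Prod>j. 1 :: 'a fps) = 1" by (rule has_prod_unique[OF has_prod_one, symmetric])
  ultimately show ?thesis
    unfolding prodinf_one_mod_powers_mult[OF one_mod_powers_inverse[OF u] u, symmetric] by simp
qed

lemma prodinf_one_mod_powers_nth_0: "one_mod_powers u \<Longrightarrow> prodinf u $ 0 = 1"
  by (metis one_mod_powers_limit)

lemma prodinf_one_mod_powers_divide:
  assumes u: "one_mod_powers u" and v: "one_mod_powers v"
  shows "(\<Prod>j. u j / v j) * prodinf v = prodinf u"
proof -
  have "u j / v j * v j = u j" for j
    using one_mod_powers_nth_0[OF v, of j] by (simp add: fps_divide_unit mult.assoc inverse_mult_eq_1)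
  then show ?thesis
    unfolding prodinf_one_mod_powers_mult[OF one_mod_powers_divide[OF u v] v, symmetric] by simp
qed

lemma one_mod_powers_shift:
  assumes "one_mod_powers u"
  shows "one_mod_powers (\<lambda>j. u (n + j))"
  unfolding one_mod_powers_def
proof
  fix j
  have "q ^ Suc j dvd (q :: 'a fps) ^ Suc (n + j)" by (intro le_imp_power_dvd) simp
  moreover have "q ^ Suc (n + j) dvd u (n + j) - 1"
    using assms unfolding one_mod_powers_def by blast
  ultimately show "q ^ Suc j dvd u (n + j) - 1" by (rule dvd_trans)
qed

text \<open>Used to complete the tail product in the n-th summand of the first series to a product
  that does not depend on \<open>n\<close>.\<close>

lemma prodinf_one_mod_powers_split:
  assumes u: "one_mod_powers u"
  shows "prodinf u = (\<Prod>j<n. u j) * (\<Prod>j. u (n + j))"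
proof -
  obtain M where M: "(\<lambda>N. \<Prod>j<N. u (n + j)) \<longlonglongrightarrow> M" "prodinf (\<lambda>j. u (n + j)) = M"
    by (rule one_mod_powers_limit[OF one_mod_powers_shift[OF u]])
  obtain L where L: "(\<lambda>N. \<Prod>j<N. u j) \<longlonglongrightarrow> L" "prodinf u = L"
    by (rule one_mod_powers_limit[OF u])
  have "(\<Prod>j<N + n. u j) = (\<Prod>j<n. u j) * (\<Prod>j<N. u (n + j))" for N
    by (induction N) (simp_all add: ac_simps)
  then have "(\<lambda>N. \<Prod>j<N + n. u j) \<longlonglongrightarrow> (\<Prod>j<n. u j) * M"
    using tendsto_mult[OF tendsto_const M(1)] by simp
  then show ?thesis
    using LIMSEQ_unique[OF LIMSEQ_ignore_initial_segment[OF L(1), of n]] L(2) M(2) by simp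
qed

text \<open>Multiplication by \<open>c\<close> is continuous, so it passes to the limit of the
  partial sums.\<close>

lemma fps_suminf_mult:
  fixes a :: "nat \<Rightarrow> 'a::field fps"
  assumes "summable a"
  shows "summable (\<lambda>n. c * a n)" "(\<Sum>n. c * a n) = c * suminf a"
proof -
  have "(\<lambda>N. c * (\<Sum>n<N. a n)) \<longlonglongrightarrow> c * suminf a"
    by (intro tendsto_mult tendsto_const summable_LIMSEQ assms)
  then have "(\<lambda>n. c * a n) sums (c * suminf a)"
    by (simp add: sums_def sum_distrib_left)
  then show "summable (\<lambda>n. c * a n)" "(\<Sum>n. c * a n) = c * suminf a"
    by (simp_all add: sums_iff)
qed

section \<open>The Bailey chain\<close>

text \<open>The reciprocal of the q-Pochhammer symbol \<open>(p; p)\<^sub>n\<close>, with the convention 0 at negative \<open>n\<close>, which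
  lets the recurrence \<open>(1 - p\<^sup>n) / (p; p)\<^sub>n = 1 / (p; p)\<^sub>n\<^sub>-\<^sub>1\<close> hold at \<open>n = 0\<close> as well.\<close>

definition inv_poch :: "'a::field fps \<Rightarrow> int \<Rightarrow> 'a fps" where
  "inv_poch p n = (if n < 0 then 0 else inverse (\<Prod>j=1..nat n. 1 - p ^ j))"

lemma inv_poch_neg [simp]: "n < 0 \<Longrightarrow> inv_poch p n = 0"
  by (simp add: inv_poch_def)

lemma inv_poch_0 [simp]: "inv_poch p 0 = 1"
  by (simp add: inv_poch_def)

lemma inv_poch_int: "inv_poch p (int n) = inverse (\<Prod>j=1..n. 1 - p ^ j)"
  by (simp add: inv_poch_def)

lemma fps_nth_0_power: "p $ 0 = 0 \<Longrightarrow> j > 0 \<Longrightarrow> (p ^ j) $ 0 = (0 :: 'a::field)"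
  by (simp add: fps_power_zeroth_eq_one power_0_left fps_power_zeroth)

lemma fps_nth_0_prod: "(\<Prod>j\<in>A. f j) $ 0 = (\<Prod>j\<in>A. f j $ 0 :: 'a::field)"
  by (induction A rule: infinite_finite_induct) auto

lemma inv_poch_rec:
  assumes "p $ 0 = (0 :: 'a::field)" "n \<ge> 0"
  shows "(1 - p ^ nat n) * inv_poch p n = inv_poch p (n - 1)"
proof (cases "n = 0")
  case False
  then obtain m where m: "n = int (Suc m)"
    using assms(2) by (metis gr0_implies_Suc nat_0_le nat_eq_iff2 neq0_conv of_nat_0)
  have u: "(1 - p ^ Suc m) $ 0 \<noteq> 0"
    using assms(1) by (simp add: fps_nth_0_power del: power_Suc)
  have "inv_poch p n = inverse (1 - p ^ Suc m) * inv_poch p (int m)"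
    unfolding m inv_poch_int by (simp add: fps_inverse_mult mult.commute del: power_Suc)
  moreover have "nat n = Suc m" "n - 1 = int m" using m by simp_all
  moreover have "(1 - p ^ Suc m) * (inverse (1 - p ^ Suc m) * inv_poch p (int m)) = inv_poch p (int m)"
    unfolding mult.assoc[symmetric] inverse_mult_eq_1'[OF u] by simp
  ultimately show ?thesis by (simp only:)
qed simp

lemma one_minus_power_neq_0: "p $ 0 = (0 :: 'a::field) \<Longrightarrow> n > 0 \<Longrightarrow> 1 - p ^ n \<noteq> 0"
  by (metis fps_nth_0_power fps_one_nth eq_iff_diff_eq_0 zero_neq_one)

text \<open>Induction on \<open>n\<close> for all \<open>a\<close> at once: multiplying the sum
  \<open>S (n + 1) a\<close> by \<open>1 - p ^ (n + 1)\<close> splits it into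
  \<open>S n a + p ^ (n + 1 + a) * S n (a + 1)\<close>, and both parts are known. This is the
  limiting case of q-Vandermonde in which one upper parameter tends to infinity.\<close>

lemma q_Vandermonde:
  fixes p :: "'a::field fps"
  assumes p: "p $ 0 = 0"
  shows "(\<Sum>t\<le>n. p ^ (t * (t + a)) * inv_poch p (int n - int t) * inv_poch p (int t) * inv_poch p (int (t + a)))
    = inv_poch p (int n) * inv_poch p (int (n + a))"
proof (induction n arbitrary: a)
  case (Suc n)
  define w where "w = inv_poch p"
  define S where "S n a = (\<Sum>t\<le>n. p ^ (t * (t + a)) * w (int n - int t) * w (int t) * w (int (t + a)))" for n a
  have rec: "(1 - p ^ nat i) * w i = w (i - 1)" if "i \<ge> 0" for i
    unfolding w_def using inv_poch_rec[OF p that] .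
  have neg: "w i = 0" if "i < 0" for i
    unfolding w_def using that by simp
  have IH: "S n a = w (int n) * w (int (n + a))" for a
    using Suc.IH[of a] by (simp add: S_def w_def)
  have split: "(1 - p ^ Suc n) * (p ^ (t * (t + a)) * w (int (Suc n) - int t) * w (int t) * w (int (t + a)))
      = p ^ (t * (t + a)) * w (int n - int t) * w (int t) * w (int (t + a))
      + p ^ (Suc n - t) * p ^ (t * (t + a)) * w (int (Suc n) - int t) * w (int t - 1) * w (int (t + a))"
    if "t \<le> Suc n" for t
  proof -
    \<comment> \<open>Each part of this splitting supplies the factor that lowers the index of one
      reciprocal symbol.\<close>
    have e: "(1 - p ^ Suc n) = (1 - p ^ (Suc n - t)) + p ^ (Suc n - t) * (1 - p ^ t)"
      using that by (simp add: algebra_simps flip: power_add)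
    have r1: "(1 - p ^ (Suc n - t)) * w (int (Suc n) - int t) = w (int n - int t)"
    proof -
      have "int (Suc n) - int t = int (Suc n - t)" "int n - int t = int (Suc n - t) - 1"
        using that by (auto simp: of_nat_diff)
      then show ?thesis using rec[of "int (Suc n - t)"] by (simp only: nat_int of_nat_0_le_iff)
    qed
    have r2: "(1 - p ^ t) * w (int t) = w (int t - 1)"
      using rec[of "int t"] by simp
    show ?thesis
      unfolding e r1[symmetric] r2[symmetric] by (simp only: algebra_simps)
  qed
  have "(1 - p ^ Suc n) * S (Suc n) a = (\<Sum>t\<le>Suc n. p ^ (t * (t + a)) * w (int n - int t) * w (int t) * w (int (t + a)))
      + (\<Sum>t\<le>Suc n. p ^ (Suc n - t) * p ^ (t * (t + a)) * w (int (Suc n) - int t) * w (int t - 1) * w (int (t + a)))"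
    unfolding S_def sum_distrib_left sum.distrib[symmetric]
    by (intro sum.cong refl split) simp
  \<comment> \<open>The extra term \<open>t = n + 1\<close> carries
    \<open>w (- 1) = 0\<close>.\<close>
  also have "(\<Sum>t\<le>Suc n. p ^ (t * (t + a)) * w (int n - int t) * w (int t) * w (int (t + a))) = S n a"
    by (simp add: S_def neg)
  \<comment> \<open>Here the term \<open>t = 0\<close> carries \<open>w (- 1) = 0\<close>, which
    permits the shift of \<open>t\<close>.\<close>
  also have "(\<Sum>t\<le>Suc n. p ^ (Suc n - t) * p ^ (t * (t + a)) * w (int (Suc n) - int t) * w (int t - 1) * w (int (t + a)))
      = (\<Sum>t\<le>n. p ^ (n - t) * p ^ (Suc t * (Suc t + a)) * w (int n - int t) * w (int t) * w (int (Suc t + a)))"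
    by (subst sum.atMost_Suc_shift) (simp add: neg del: power_Suc)
  also have "\<dots> = p ^ (Suc n + a) * S n (Suc a)"
    unfolding S_def sum_distrib_left
  proof (intro sum.cong refl)
    fix t assume "t \<in> {..n}"
    then have "(n - t) + Suc t * (Suc t + a) = (Suc n + a) + t * (t + Suc a)"
      by (simp add: algebra_simps)
    then show "p ^ (n - t) * p ^ (Suc t * (Suc t + a)) * w (int n - int t) * w (int t) * w (int (Suc t + a))
       = p ^ (Suc n + a) * (p ^ (t * (t + Suc a)) * w (int n - int t) * w (int t) * w (int (t + Suc a)))"
      by (simp only: mult.assoc[symmetric] power_add[symmetric]) simp
  qed
  also have "S n a + p ^ (Suc n + a) * S n (Suc a)
      = w (int n) * (w (int (n + a)) + p ^ (Suc n + a) * w (int (Suc n + a)))"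
    by (simp add: IH algebra_simps del: power_Suc)
  \<comment> \<open>Raising the index makes the two powers of \<open>p\<close> cancel, leaving a
    single reciprocal symbol.\<close>
  also have "w (int (n + a)) = (1 - p ^ (Suc n + a)) * w (int (Suc n + a))"
    using rec[of "int (Suc n + a)"] by (simp only: nat_int of_nat_0_le_iff) simp
  also have "w (int n) * ((1 - p ^ (Suc n + a)) * w (int (Suc n + a)) + p ^ (Suc n + a) * w (int (Suc n + a)))
      = w (int n) * w (int (Suc n + a))"
    by (simp add: algebra_simps del: power_Suc)
  also have "w (int n) = (1 - p ^ Suc n) * w (int (Suc n))"
    using rec[of "int (Suc n)"] by (simp only: nat_int of_nat_0_le_iff) simp
  finally have "(1 - p ^ Suc n) * S (Suc n) a = (1 - p ^ Suc n) * (w (int (Suc n)) * w (int (Suc n + a)))"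
    by (simp only: mult.assoc)
  then have "S (Suc n) a = w (int (Suc n)) * w (int (Suc n + a))"
    using one_minus_power_neq_0[OF p, of "Suc n"] by (metis mult_left_cancel zero_less_Suc)
  then show ?case by (simp only: S_def w_def)
qed simp

text \<open>This is beta_N of a Bailey pair relative to 1 in bilateral form: \<open>m\<close> takes
  both signs, so \<open>\<alpha>\<close> need not be an even function.\<close>

definition bailey_sum :: "'a::field fps \<Rightarrow> (int \<Rightarrow> 'a fps) \<Rightarrow> int \<Rightarrow> 'a fps" where
  "bailey_sum p \<alpha> N = (\<Sum>m=-N..N. \<alpha> m * inv_poch p (N - m) * inv_poch p (N + m))"

text \<open>With \<open>s = m + t\<close> the exponent becomes
  \<open>m\<^sup>2 + t * (t + 2 * m)\<close>, so this is \<open>q_Vandermonde\<close> with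
  \<open>a = 2 * m\<close>.\<close>

lemma bailey_kernel:
  fixes p :: "'a::field fps"
  assumes p: "p $ 0 = 0"
  shows "(\<Sum>s=0..N. p ^ nat (s\<^sup>2) * inv_poch p (N - s) * inv_poch p (s - m) * inv_poch p (s + m))
    = p ^ nat (m\<^sup>2) * inv_poch p (N - m) * inv_poch p (N + m)"
proof -
  \<comment> \<open>Both sides are even in \<open>m\<close>, so nonnegative \<open>m\<close>
    suffices. For \<open>m > N\<close> every term and the right side contain a reciprocal symbol at
    a negative argument.\<close>
  have pos: "(\<Sum>s=0..N. p ^ nat (s\<^sup>2) * inv_poch p (N - s) * inv_poch p (s - int m) * inv_poch p (s + int m))
    = p ^ nat ((int m)\<^sup>2) * inv_poch p (N - int m) * inv_poch p (N + int m)" for m :: nat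
  proof (cases "int m \<le> N")
    case False
    then show ?thesis by (auto intro!: sum.neutral)
  next
    case True
    then obtain n where n: "N = int m + int n"
      by (metis zle_iff_zadd)
    have "(\<Sum>s=0..N. p ^ nat (s\<^sup>2) * inv_poch p (N - s) * inv_poch p (s - int m) * inv_poch p (s + int m))
      = (\<Sum>s=int m..N. p ^ nat (s\<^sup>2) * inv_poch p (N - s) * inv_poch p (s - int m) * inv_poch p (s + int m))"
      by (rule sum.mono_neutral_right) auto
    also have "\<dots> = (\<Sum>t\<le>n. p ^ nat ((int m + int t)\<^sup>2) * inv_poch p (int n - int t) * inv_poch p (int t)
        * inv_poch p (int (t + 2 * m)))"
      by (rule sum.reindex_bij_witness[of _ "\<lambda>t. int m + int t" "\<lambda>s. nat (s - int m)"])
        (auto simp: n algebra_simps)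
    also have "\<dots> = p ^ (m\<^sup>2) * (\<Sum>t\<le>n. p ^ (t * (t + 2 * m)) * inv_poch p (int n - int t)
        * inv_poch p (int t) * inv_poch p (int (t + 2 * m)))"
      unfolding sum_distrib_left
    proof (intro sum.cong refl)
      fix t
      have "(int m + int t)\<^sup>2 = int (m\<^sup>2 + t * (t + 2 * m))"
        by (simp add: power2_eq_square algebra_simps)
      then have "nat ((int m + int t)\<^sup>2) = m\<^sup>2 + t * (t + 2 * m)"
        by (simp only: nat_int)
      then show "p ^ nat ((int m + int t)\<^sup>2) * inv_poch p (int n - int t) * inv_poch p (int t) * inv_poch p (int (t + 2 * m))
        = p ^ (m\<^sup>2) * (p ^ (t * (t + 2 * m)) * inv_poch p (int n - int t) * inv_poch p (int t) * inv_poch p (int (t + 2 * m)))"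
        by (simp only: power_add mult.assoc)
    qed
    also have "\<dots> = p ^ (m\<^sup>2) * (inv_poch p (int n) * inv_poch p (int (n + 2 * m)))"
      by (simp only: q_Vandermonde[OF p])
    also have "\<dots> = p ^ nat ((int m)\<^sup>2) * inv_poch p (N - int m) * inv_poch p (N + int m)"
    proof -
      have "nat ((int m)\<^sup>2) = m\<^sup>2" "int n = N - int m" "int (n + 2 * m) = N + int m"
        by (simp_all add: n nat_power_eq)
      then show ?thesis by (simp only: mult.assoc)
    qed
    finally show ?thesis .
  qed
  show ?thesis
  proof (cases "m \<ge> 0")
    case True
    then show ?thesis using pos[of "nat m"] by simp
  next
    case False
    then show ?thesis using pos[of "nat (-m)"] by (simp add: ac_simps)
  qed
qed

text \<open>After exchanging the two sums, the inner sum over \<open>s\<close> is the one evaluated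
  in \<open>bailey_kernel\<close>.\<close>

lemma bailey_chain:
  fixes p :: "'a::field fps"
  assumes p: "p $ 0 = 0"
  shows "(\<Sum>s=0..N. p ^ nat (s\<^sup>2) * inv_poch p (N - s) * bailey_sum p \<alpha> s)
    = bailey_sum p (\<lambda>m. p ^ nat (m\<^sup>2) * \<alpha> m) N"
proof -
  have "(\<Sum>s=0..N. p ^ nat (s\<^sup>2) * inv_poch p (N - s) * bailey_sum p \<alpha> s)
    = (\<Sum>s=0..N. \<Sum>m=-N..N. \<alpha> m * (p ^ nat (s\<^sup>2) * inv_poch p (N - s) * inv_poch p (s - m) * inv_poch p (s + m)))"
  proof (intro sum.cong refl)
    fix s assume "s \<in> {0..N}"
    \<comment> \<open>The terms with \<open>\<bar>m\<bar> > s\<close> vanish, so the range of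
      \<open>m\<close> can be made independent of \<open>s\<close>.\<close>
    then have "bailey_sum p \<alpha> s = (\<Sum>m=-N..N. \<alpha> m * inv_poch p (s - m) * inv_poch p (s + m))"
      unfolding bailey_sum_def by (intro sum.mono_neutral_left) auto
    then show "p ^ nat (s\<^sup>2) * inv_poch p (N - s) * bailey_sum p \<alpha> s
      = (\<Sum>m=-N..N. \<alpha> m * (p ^ nat (s\<^sup>2) * inv_poch p (N - s) * inv_poch p (s - m) * inv_poch p (s + m)))"
      by (simp add: sum_distrib_left ac_simps)
  qed
  also have "\<dots> = (\<Sum>m=-N..N. \<alpha> m * (\<Sum>s=0..N. p ^ nat (s\<^sup>2) * inv_poch p (N - s) * inv_poch p (s - m) * inv_poch p (s + m)))"
    by (subst sum.swap) (simp add: sum_distrib_left)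
  also have "\<dots> = bailey_sum p (\<lambda>m. p ^ nat (m\<^sup>2) * \<alpha> m) N"
    unfolding bailey_kernel[OF p] by (simp add: bailey_sum_def ac_simps)
  finally show ?thesis .
qed

section \<open>The finite Jacobi triple product\<close>

text \<open>The coefficients \<open>c m = (-z)\<^sup>m (zy)\<^bsup>m(m-1)/2\<^esup>\<close> of the Jacobi triple product in base \<open>zy\<close>; the recursion in both
  directions avoids the negative powers of \<open>z\<close>.\<close>

definition theta_coeffs :: "'a::field fps \<Rightarrow> 'a fps \<Rightarrow> (int \<Rightarrow> 'a fps) \<Rightarrow> bool" where
  "theta_coeffs z y c \<longleftrightarrow> c 0 = 1 \<and>
    (\<forall>m. c (int m + 1) = - (z * (z * y) ^ m * c (int m))) \<and>
    (\<forall>m. c (- int m - 1) = - (y * (z * y) ^ m * c (- int m)))"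

lemma theta_coeffs_reflect: "theta_coeffs z y c \<Longrightarrow> theta_coeffs y z (\<lambda>m. c (- m))"
proof -
  have "- (int m + 1) = - int m - 1" "- (- int m - 1) = int m + 1" for m by simp_all
  then show "theta_coeffs z y c \<Longrightarrow> theta_coeffs y z (\<lambda>m. c (- m))"
    by (simp only: theta_coeffs_def mult.commute[of y z] minus_minus minus_zero simp_thms)
qed

text \<open>Both recursions say \<open>c m = - z * (z * y) ^ (m - 1) * c (m - 1)\<close> formally.
  The extra power clears negative exponents, so that one formula covers both signs of
  \<open>m\<close>.\<close>

lemma theta_coeffs_shift:
  assumes c: "theta_coeffs z y c" and m: "m \<le> int a + 1"
  shows "c m * (z * y) ^ nat (int a + 1 - m) = - (z * (z * y) ^ a * c (m - 1))"
proof (cases "m \<ge> 1")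
  case True
  define n where "n = nat (m - 1)"
  have n: "m = int n + 1" "n \<le> a" using True m by (auto simp: n_def)
  have "c m = - (z * (z * y) ^ n * c (int n))"
    using c by (simp add: n theta_coeffs_def)
  moreover have "nat (int a + 1 - m) = a - n" "m - 1 = int n"
    using n by auto
  moreover have "(z * y) ^ a = (z * y) ^ n * (z * y) ^ (a - n)"
    using n(2) by (simp flip: power_add)
  ultimately show ?thesis by (simp only: mult_minus_left mult_minus_right ac_simps)
next
  case False
  define n where "n = nat (- m)"
  have n: "m = - int n" using False by (auto simp: n_def)
  have "c (m - 1) = - (y * (z * y) ^ n * c m)"
    using c unfolding n theta_coeffs_def by blast
  moreover have "nat (int a + 1 - m) = Suc (a + n)"
    using n by auto
  moreover have "(z * y) ^ Suc (a + n) = z * y * ((z * y) ^ a * (z * y) ^ n)"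
    by (simp add: power_add)
  ultimately show ?thesis by (simp only: mult_minus_left mult_minus_right minus_minus ac_simps)
qed

text \<open>Separate bounds at the two ends let the induction for the triple product add its factors
  one at a time.\<close>

definition rect_sum :: "'a::field fps \<Rightarrow> (int \<Rightarrow> 'a fps) \<Rightarrow> int \<Rightarrow> int \<Rightarrow> 'a fps" where
  "rect_sum p c a b = (\<Sum>m=-b..a. c m * inv_poch p (a - m) * inv_poch p (b + m))"

lemma rect_sum_diag: "rect_sum p c N N = bailey_sum p c N"
  by (simp add: rect_sum_def bailey_sum_def)

lemma rect_sum_reflect: "rect_sum p (\<lambda>m. c (- m)) b a = rect_sum p c a b"
  unfolding rect_sum_def
  by (rule sum.reindex_bij_witness[of _ uminus uminus]) (auto simp: ac_simps)

text \<open>With \<open>i = a + 1 - m\<close> and \<open>j = b + m\<close>, the sum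
  \<open>i + j\<close> does not depend on \<open>m\<close>, and
  \<open>1 - Q ^ (i + j) = (1 - Q ^ i) + Q ^ i * (1 - Q ^ j)\<close>. The first part gives the old
  sum; in the second, \<open>c m * Q ^ i\<close> turns into \<open>c (m - 1)\<close>, which gives
  the old sum again after a shift.\<close>

lemma rect_sum_step:
  fixes z y :: "'a::field fps"
  assumes Q: "(z * y) $ 0 = 0" and c: "theta_coeffs z y c"
  shows "(1 - (z * y) ^ (a + b + 1)) * rect_sum (z * y) c (int a + 1) (int b)
    = (1 - z * (z * y) ^ a) * rect_sum (z * y) c (int a) (int b)"
proof -
  define Q where "Q = z * y"
  define w where "w = inv_poch Q"
  have rec: "(1 - Q ^ nat i) * w i = w (i - 1)" if "i \<ge> 0" for i
    unfolding w_def Q_def using inv_poch_rec[OF Q that] .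
  have neg: "w i = 0" if "i < 0" for i
    unfolding w_def using that by simp
  have summand: "(1 - Q ^ (a + b + 1)) * (c m * w (int a + 1 - m) * w (int b + m))
    = c m * w (int a - m) * w (int b + m)
      - z * Q ^ a * (c (m - 1) * w (int a - (m - 1)) * w (int b + (m - 1)))"
    if "- int b \<le> m" "m \<le> int a + 1" for m
  proof -
    define i where "i = nat (int a + 1 - m)"
    define j where "j = nat (int b + m)"
    have ij: "a + b + 1 = i + j" using that by (simp add: i_def j_def)
    have r1: "(1 - Q ^ i) * w (int a + 1 - m) = w (int a - m)"
      using rec[of "int a + 1 - m"] that by (simp add: i_def algebra_simps)
    have r2: "(1 - Q ^ j) * w (int b + m) = w (int b + (m - 1))"
      using rec[of "int b + m"] that by (simp add: j_def algebra_simps)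
    have s: "z * Q ^ a * c (m - 1) = - (c m * Q ^ i)"
      using theta_coeffs_shift[OF c that(2)] by (simp add: Q_def i_def)
    have s': "z * Q ^ a * (c (m - 1) * u * v) = - (c m * Q ^ i) * u * v" for u v
      by (simp only: s[symmetric] mult.assoc)
    have e: "int a - (m - 1) = int a + 1 - m" by simp
    show ?thesis
      unfolding ij s' e r1[symmetric] r2[symmetric] by (simp add: algebra_simps power_add)
  qed
  have "(1 - Q ^ (a + b + 1)) * rect_sum Q c (int a + 1) (int b)
    = (\<Sum>m=-int b..int a + 1. c m * w (int a - m) * w (int b + m))
      - z * Q ^ a * (\<Sum>m=-int b..int a + 1. c (m - 1) * w (int a - (m - 1)) * w (int b + (m - 1)))"
    unfolding rect_sum_def w_def[symmetric] sum_distrib_left sum_subtractf[symmetric]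
    by (intro sum.cong refl summand) auto
  \<comment> \<open>The boundary term \<open>m = a + 1\<close> vanishes, as does
    \<open>m = - b - 1\<close> after the shift below.\<close>
  also have "(\<Sum>m=-int b..int a + 1. c m * w (int a - m) * w (int b + m)) = rect_sum Q c (int a) (int b)"
    unfolding rect_sum_def w_def[symmetric] by (rule sum.mono_neutral_right) (auto simp: neg)
  also have "(\<Sum>m=-int b..int a + 1. c (m - 1) * w (int a - (m - 1)) * w (int b + (m - 1)))
    = (\<Sum>m=-int b-1..int a. c m * w (int a - m) * w (int b + m))"
    by (rule sum.reindex_bij_witness[of _ "\<lambda>m. m + 1" "\<lambda>m. m - 1"]) auto
  also have "\<dots> = rect_sum Q c (int a) (int b)"
    unfolding rect_sum_def w_def[symmetric] by (rule sum.mono_neutral_right) (auto simp: neg)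
  finally show ?thesis by (simp add: Q_def algebra_simps)
qed

text \<open>Passing from \<open>N\<close> to \<open>N + 1\<close> takes two steps: raising the upper
  bound yields the factor with \<open>z\<close>, and lowering the lower bound yields the one with
  \<open>y\<close>.\<close>

lemma finite_jacobi_triple_product:
  fixes z y :: "'a::field fps"
  assumes Q: "(z * y) $ 0 = 0" and c: "theta_coeffs z y c"
  shows "bailey_sum (z * y) c (int N)
    = (\<Prod>j<N. (1 - z * (z * y) ^ j) * (1 - y * (z * y) ^ j)) * inv_poch (z * y) (2 * int N)"
proof (induction N)
  case 0
  then show ?case using c by (simp add: bailey_sum_def theta_coeffs_def)
next
  case (Suc N)
  define Q' where "Q' = z * y"
  define R where "R = rect_sum Q' c"
  have Q0: "Q' $ 0 = 0" using Q by (simp add: Q'_def)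
  have r1: "(1 - Q' ^ (2 * N + 1)) * R (int N + 1) (int N) = (1 - z * Q' ^ N) * R (int N) (int N)"
    using rect_sum_step[OF Q c, of N N] by (simp only: R_def Q'_def mult_2)
  \<comment> \<open>Lowering the lower bound is raising the upper one after the reflection of
    \<open>m\<close>, which exchanges \<open>z\<close> and \<open>y\<close>.\<close>
  have "(1 - Q' ^ (N + (N + 1) + 1)) * R (int N + 1) (int N + 1) = (1 - y * Q' ^ N) * R (int N + 1) (int N)"
    using rect_sum_step[OF _ theta_coeffs_reflect[OF c], of N "N + 1"] Q
    by (simp only: R_def Q'_def mult.commute[of y z] rect_sum_reflect of_nat_add of_nat_1)
  then have r2: "(1 - Q' ^ (2 * N + 2)) * R (int N + 1) (int N + 1) = (1 - y * Q' ^ N) * R (int N + 1) (int N)"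
    by (simp only: mult_2 add.assoc one_add_one)
  have w1: "(1 - Q' ^ (2 * N + 1)) * inv_poch Q' (2 * int N + 1) = inv_poch Q' (2 * int N)"
    using inv_poch_rec[OF Q0, of "int (2 * N + 1)"] by (simp only: nat_int of_nat_0_le_iff) (simp add: add.commute)
  have w2: "(1 - Q' ^ (2 * N + 2)) * inv_poch Q' (2 * int N + 2) = inv_poch Q' (2 * int N + 1)"
    using inv_poch_rec[OF Q0, of "int (2 * N + 2)"] by (simp only: nat_int of_nat_0_le_iff) (simp add: add.commute)
  define P where "P = (\<Prod>j<N. (1 - z * Q' ^ j) * (1 - y * Q' ^ j))"
  define D where "D = (1 - Q' ^ (2 * N + 1)) * (1 - Q' ^ (2 * N + 2))"
  have IH: "R (int N) (int N) = P * inv_poch Q' (2 * int N)"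
    using Suc.IH by (simp only: R_def Q'_def P_def rect_sum_diag)
  have "D * R (int N + 1) (int N + 1) = (1 - Q' ^ (2 * N + 1)) * ((1 - Q' ^ (2 * N + 2)) * R (int N + 1) (int N + 1))"
    by (simp only: D_def mult.assoc)
  also have "\<dots> = (1 - y * Q' ^ N) * ((1 - Q' ^ (2 * N + 1)) * R (int N + 1) (int N))"
    unfolding r2 by (rule mult.left_commute)
  also have "\<dots> = (1 - y * Q' ^ N) * ((1 - z * Q' ^ N) * (P * inv_poch Q' (2 * int N)))"
    by (simp only: r1 IH)
  also have "inv_poch Q' (2 * int N) = D * inv_poch Q' (2 * int N + 2)"
    unfolding D_def by (simp only: mult.assoc w1 w2)
  also have "(1 - y * Q' ^ N) * ((1 - z * Q' ^ N) * (P * (D * inv_poch Q' (2 * int N + 2))))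
    = D * ((P * ((1 - z * Q' ^ N) * (1 - y * Q' ^ N))) * inv_poch Q' (2 * int N + 2))"
    by (simp only: ac_simps)
  finally have "D * R (int N + 1) (int N + 1)
    = D * ((P * ((1 - z * Q' ^ N) * (1 - y * Q' ^ N))) * inv_poch Q' (2 * int N + 2))" .
  moreover have "D \<noteq> 0"
    unfolding D_def mult_eq_0_iff de_Morgan_disj by (intro conjI one_minus_power_neq_0[OF Q0]) auto
  ultimately have "R (int N + 1) (int N + 1)
    = (P * ((1 - z * Q' ^ N) * (1 - y * Q' ^ N))) * inv_poch Q' (2 * int N +

 2)"
    by (simp only: mult_cancel_left simp_thms)
  moreover have "int (Suc N) = int N + 1" "2 * int (Suc N) = 2 * int N + 2" by simp_all
  ultimately show ?case
    by (simp only: R_def P_def Q'_def rect_sum_diag prod.lessThan_Suc)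
qed

section \<open>Explicit theta coefficients and the two-step Bailey chain\<close>

definition theta_exp :: "int \<Rightarrow> int \<Rightarrow> int \<Rightarrow> int" where
  "theta_exp d r m = d * (m * (m - 1) div 2) + r * m"

lemma triangular_succ: "(m + 1) * m div 2 = m * (m - 1) div 2 + (m :: int)"
proof -
  have "(m + 1) * m = m * (m - 1) + m * 2" by (simp add: algebra_simps)
  then show ?thesis by simp
qed

lemma theta_exp_0 [simp]: "theta_exp d r 0 = 0"
  by (simp add: theta_exp_def)

lemma theta_exp_up: "theta_exp d r (m + 1) = theta_exp d r m + d * m + r"
  using triangular_succ[of m] by (simp add: theta_exp_def algebra_simps)

lemma theta_exp_down: "theta_exp d r (- m - 1) = theta_exp d r (- m) + d * m + (d - r)"
  using theta_exp_up[of d r "- m - 1"] by (simp add: algebra_simps)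

text \<open>The increments away from 0 are \<open>d * m + r\<close> and
  \<open>d * m + (d - r)\<close>, both at least \<open>l\<close>. The case \<open>l = 0\<close>
  makes \<open>nat\<close> harmless; \<open>l = 1\<close> gives the X-adic decay of the theta
  terms.\<close>

lemma theta_exp_ge:
  assumes "l \<ge> 0" "l \<le> r" "l \<le> d - r"
  shows "theta_exp d r m \<ge> l * \<bar>m\<bar>"
proof -
  have "d \<ge> 0" using assms by simp
  have "theta_exp d r (int n) \<ge> l * int n \<and> theta_exp d r (- int n) \<ge> l * int n" for n
  proof (induction n)
    case (Suc n)
    have "d * int n \<ge> 0" using \<open>d \<ge> 0\<close> by simp
    then have "l * int n + l \<le> theta_exp d r (int n + 1)" "l * int n + l \<le> theta_exp d r (- int n - 1)"
      using Suc theta_exp_up[of d r "int n"] theta_exp_down[of d r "int n"] assms by linarith+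
    moreover have "int (Suc n) = int n + 1" "- int (Suc n) = - int n - 1" by simp_all
    ultimately show ?case by (simp only: distrib_left mult_1_right)
  qed simp
  from this[of "nat \<bar>m\<bar>"] show ?thesis by (cases "m \<ge> 0") auto
qed

text \<open>The exponent is m(m-1)/2 for \<open>d = 1\<close>, \<open>r = 0\<close> and m(5m-1)/2
  for \<open>d = 5\<close>, \<open>r = 2\<close>.\<close>

definition theta_term :: "'a::field fps \<Rightarrow> nat \<Rightarrow> nat \<Rightarrow> int \<Rightarrow> 'a fps" where
  "theta_term p d r m = (-1) ^ nat \<bar>m\<bar> * p ^ nat (theta_exp (int d) (int r) m)"

lemma theta_coeffs_theta_term:
  assumes "r \<le> d"
  shows "theta_coeffs (p ^ r) (p ^ (d - r)) (theta_term p d r)"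
proof -
  have d: "p ^ r * p ^ (d - r) = p ^ d"
    using assms by (simp flip: power_add)
  have nn: "theta_exp (int d) (int r) m \<ge> 0" for m
    using theta_exp_ge[of 0 "int r" "int d" m] assms by simp
  have up: "theta_term p d r (int m + 1) = - (p ^ r * (p ^ d) ^ m * theta_term p d r (int m))" for m
  proof -
    have "nat (theta_exp (int d) (int r) (int m + 1)) = r + d * m + nat (theta_exp (int d) (int r) (int m))"
      unfolding theta_exp_up using nn[of "int m"]
      by (simp add: nat_eq_iff)
    moreover have "nat \<bar>int m + 1\<bar> = Suc (nat \<bar>int m\<bar>)" by simp
    ultimately show ?thesis
      by (simp only: theta_term_def power_add power_mult power_Suc) (simp add: ac_simps)
  qed
  have down: "theta_term p d r (- int m - 1) = - (p ^ (d - r) * (p ^ d) ^ m * theta_term p d r (- int m))" for m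
  proof -
    have "nat (theta_exp (int d) (int r) (- int m - 1))
      = (d - r) + d * m + nat (theta_exp (int d) (int r) (- int m))"
      unfolding theta_exp_down using nn[of "- int m"] assms
      by (simp add: nat_eq_iff of_nat_diff)
    moreover have "nat \<bar>- int m - 1\<bar> = Suc (nat \<bar>- int m\<bar>)" by simp
    ultimately show ?thesis
      by (simp only: theta_term_def power_add power_mult power_Suc) (simp add: ac_simps)
  qed
  show ?thesis
    unfolding theta_coeffs_def d using up down by (simp add: theta_term_def)
qed

text \<open>In the triple product with \<open>z = 1\<close> and \<open>y = p\<close> the factor
  \<open>1 - z\<close> at \<open>j = 0\<close> vanishes as soon as the product is nonempty.\<close>

lemma bailey_sum_unit:
  fixes p :: "'a::field fps"
  assumes p: "p $ 0 = 0"
  shows "bailey_sum p (theta_term p 1 0) (int N) = (if N = 0 then 1 else 0)"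
proof -
  have "theta_coeffs 1 p (theta_term p 1 0)"
    using theta_coeffs_theta_term[of 0 1 p] by simp
  from finite_jacobi_triple_product[OF _ this, of N] p
  have "bailey_sum p (theta_term p 1 0) (int N)
    = (\<Prod>j<N. (1 - p ^ j) * (1 - p * p ^ j)) * inv_poch p (2 * int N)" by simp
  moreover have "(\<Prod>j<N. (1 - p ^ j) * (1 - p * p ^ j)) = 0" if "N \<noteq> 0"
    using that by (intro prod_zero) (auto intro!: bexI[of _ 0])
  ultimately show ?thesis by simp
qed

lemma finite_rogers_ramanujan:
  fixes p :: "'a::field fps"
  assumes p: "p $ 0 = 0"
  shows "(\<Sum>s=0..int N. p ^ nat (s\<^sup>2) * inv_poch p (int N - s) * inv_poch p s)
    = bailey_sum p (theta_term p 5 2) (int N)"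
proof -
  define \<alpha> where "\<alpha> = theta_term p 1 0"
  have unit: "bailey_sum p \<alpha> s = (if s = 0 then 1 else 0)" if "s \<ge> 0" for s
    using bailey_sum_unit[OF p, of "nat s"] that by (simp add: \<alpha>_def)
  \<comment> \<open>In the first step of the chain only \<open>i = 0\<close> survives, so the new
    beta is a reciprocal symbol.\<close>
  have first: "bailey_sum p (\<lambda>m. p ^ nat (m\<^sup>2) * \<alpha> m) s = inv_poch p s" if "s \<ge> 0" for s
  proof -
    have "(\<Sum>i=0..s. p ^ nat (i\<^sup>2) * inv_poch p (s - i) * bailey_sum p \<alpha> i)
      = (\<Sum>i=0..s. if i = 0 then inv_poch p s else 0)"
      by (intro sum.cong) (auto simp: unit)
    then show ?thesis using that by (simp add: bailey_chain[OF p])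
  qed
  have "(\<Sum>s=0..int N. p ^ nat (s\<^sup>2) * inv_poch p (int N - s) * inv_poch p s)
    = bailey_sum p (\<lambda>m. p ^ nat (m\<^sup>2) * (p ^ nat (m\<^sup>2) * \<alpha> m)) (int N)"
    unfolding bailey_chain[OF p, symmetric] by (intro sum.cong) (auto simp: first bailey_chain[OF p])
  also have "(\<lambda>m. p ^ nat (m\<^sup>2) * (p ^ nat (m\<^sup>2) * \<alpha> m)) = theta_term p 5 2"
  proof
    fix m :: int
    \<comment> \<open>Doubling removes the \<open>div\<close>; what remains is linear in the
      quotient, \<open>m * m\<close> and \<open>m\<close>.\<close>
    have "2 * (m * (m - 1) div 2) = m * (m - 1)" by simp
    then have "theta_exp 5 2 m = m\<^sup>2 + m\<^sup>2 + theta_exp 1 0 m"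
      unfolding theta_exp_def power2_eq_square right_diff_distrib mult_1_right by linarith
    moreover have "theta_exp 1 0 m \<ge> 0" using theta_exp_ge[of 0 0 1 m] by simp
    ultimately have "nat (theta_exp 5 2 m) = nat (m\<^sup>2) + nat (m\<^sup>2) + nat (theta_exp 1 0 m)"
      by (simp add: nat_add_distrib)
    then show "p ^ nat (m\<^sup>2) * (p ^ nat (m\<^sup>2) * \<alpha> m) = theta_term p 5 2 m"
      by (simp add: \<alpha>_def theta_term_def power_add ac_simps)
  qed
  finally show ?thesis .
qed

section \<open>The Rogers--Ramanujan identity\<close>

lemma fps_X_power_dvd_power:
  assumes "p $ 0 = (0 :: 'a::field)" "n \<le> m"
  shows "q ^ n dvd p ^ m"
proof -
  have "q ^ 1 dvd p" using assms(1) by (simp only: fps_X_power_dvd_iff) simp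
  then have "q ^ m dvd p ^ m" by (simp add: dvd_power_same)
  with le_imp_power_dvd[OF assms(2)] show ?thesis by (rule dvd_trans)
qed

lemma one_mod_powers_one_minus_power:
  assumes "p $ 0 = (0 :: 'a::field)" "\<And>j. e j \<ge> Suc j"
  shows "one_mod_powers (\<lambda>j. 1 - p ^ e j)"
  unfolding one_mod_powers_def
proof
  fix j
  have "q ^ Suc j dvd p ^ e j" by (intro fps_X_power_dvd_power assms)
  then show "q ^ Suc j dvd 1 - p ^ e j - 1" by (simp del: power_Suc)
qed

text \<open>The rate is kept for all arguments \<open>i \<ge> n\<close>, because in the sums the
  arguments \<open>N - m\<close> and \<open>N + m\<close> vary with the summation index.\<close>

lemma inv_poch_limit:
  fixes p :: "'a::field fps"
  assumes p: "p $ 0 = 0"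
  obtains W where "(\<lambda>N. inv_poch p (int N)) \<longlonglongrightarrow> W" "\<forall>n i. int n \<le> i \<longrightarrow> q ^ n dvd inv_poch p i - W"
    "W * (\<Prod>j. 1 - p ^ Suc j) = 1"
proof -
  define u where "u j = 1 - p ^ Suc j" for j
  have u: "one_mod_powers u"
    unfolding u_def using p by (rule one_mod_powers_one_minus_power) simp
  have w: "inv_poch p (int n) = (\<Prod>j<n. inverse (u j))" for n
  proof (induction n)
    case (Suc n)
    have "inv_poch p (int (Suc n)) = inverse (u n) * inv_poch p (int n)"
      unfolding inv_poch_int u_def by (simp add: fps_inverse_mult mult.commute del: power_Suc)
    then show ?case by (simp add: Suc mult.commute)
  qed simp
  have ui: "one_mod_powers (\<lambda>j. inverse (u j))" using u by (rule one_mod_powers_inverse)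
  obtain W where W: "(\<lambda>n. \<Prod>j<n. inverse (u j)) \<longlonglongrightarrow> W" "\<forall>n. q ^ n dvd W - (\<Prod>j<n. inverse (u j))"
    "prodinf (\<lambda>j. inverse (u j)) = W"
    by (rule one_mod_powers_limit[OF ui])
  have dvd: "q ^ n dvd inv_poch p i - W" if "int n \<le> i" for n i
  proof -
    have "q ^ nat i dvd - (W - inv_poch p (int (nat i)))"
      unfolding w dvd_minus_iff using W(2) by blast
    then have "q ^ nat i dvd inv_poch p i - W" using that by simp
    moreover have "q ^ n dvd (q :: 'a fps) ^ nat i" using that by (intro le_imp_power_dvd) simp
    ultimately show ?thesis by (rule dvd_trans[rotated])
  qed
  have "W * prodinf u = 1"
    unfolding W(3)[symmetric] using u by (rule prodinf_one_mod_powers_inverse)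
  moreover have "(\<lambda>N. inv_poch p (int N)) \<longlonglongrightarrow> W"
    using W(1) by (simp only: w)
  ultimately show ?thesis
    using dvd unfolding u_def by (intro that[of W]) auto
qed

text \<open>X-adic dominated convergence: modulo \<open>q ^ n\<close>, the terms with
  \<open>\<bar>i\<bar> \<ge> n\<close> vanish because of \<open>c\<close> and the others because of
  \<open>d\<close>. The bound \<open>N \<ge> 2 * n\<close> ensures that \<open>N - i\<close> and
  \<open>N + i\<close> exceed \<open>n\<close>.\<close>

lemma fps_dominated_sum_tendsto_0:
  fixes c :: "int \<Rightarrow> 'a::field fps"
  assumes c: "\<And>i. q ^ nat \<bar>i\<bar> dvd c i"
    and d: "\<And>n N i. nat \<bar>i\<bar> < n \<Longrightarrow> N \<ge> 2 * n \<Longrightarrow> q ^ n dvd d N i"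
  shows "(\<lambda>N. \<Sum>i\<in>I N. c i * d N i) \<longlonglongrightarrow> 0"
  unfolding tendsto_fps_iff_dvd
proof
  fix n
  have "q ^ n dvd (\<Sum>i\<in>I N. c i * d N i)" if "N \<ge> 2 * n" for N
  proof (rule dvd_sum)
    fix i
    show "q ^ n dvd c i * d N i"
    proof (cases "nat \<bar>i\<bar> < n")
      case True
      then show ?thesis by (intro dvd_mult d that)
    next
      case False
      then have "q ^ n dvd (q :: 'a fps) ^ nat \<bar>i\<bar>" by (intro le_imp_power_dvd) simp
      from dvd_trans[OF this c] show ?thesis by (rule dvd_mult2)
    qed
  qed
  then show "eventually (\<lambda>N. q ^ n dvd (\<Sum>i\<in>I N. c i * d N i) - 0) sequentially"
    unfolding diff_0_right by (rule eventually_sequentiallyI)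
qed

lemma bailey_sum_tendsto:
  fixes p :: "'a::field fps"
  assumes w: "\<And>n i. int n \<le> i \<Longrightarrow> q ^ n dvd inv_poch p i - W"
    and c: "\<And>i. q ^ nat \<bar>i\<bar> dvd c i"
    and T: "(\<lambda>N. \<Sum>m=-int N..int N. c m) \<longlonglongrightarrow> T"
  shows "(\<lambda>N. bailey_sum p c (int N)) \<longlonglongrightarrow> W * W * T"
proof -
  have "(\<lambda>N. \<Sum>m=-int N..int N. c m * (inv_poch p (int N - m) * inv_poch p (int N + m) - W * W)) \<longlonglongrightarrow> 0"
  proof (rule fps_dominated_sum_tendsto_0[OF c])
    fix n N :: nat and i :: int
    assume "nat \<bar>i\<bar> < n" "N \<ge> 2 * n"
    then have "int n \<le> int N - i" "int n \<le> int N + i" by linarith+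
    \<comment> \<open>The difference \<open>x * y - W * W\<close> is written as
      \<open>(x - W) * y + W * (y - W)\<close>.\<close>
    then have "q ^ n dvd (inv_poch p (int N - i) - W) * inv_poch p (int N + i) + W * (inv_poch p (int N + i) - W)"
      using w by (intro dvd_add dvd_mult dvd_mult2) auto
    then show "q ^ n dvd inv_poch p (int N - i) * inv_poch p (int N + i) - W * W"
      by (simp add: algebra_simps)
  qed
  from tendsto_add[OF this tendsto_mult[OF tendsto_const T, of "W * W"]]
  show ?thesis
    by (simp add: bailey_sum_def sum_distrib_left sum.distrib[symmetric] algebra_simps)
qed

text \<open>Only \<open>inv_poch p (int N - s)\<close> depends on \<open>N\<close>, so a single
  factor \<open>W\<close> appears; \<open>p ^ nat (s\<^sup>2)\<close> supplies the
  domination.\<close>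

lemma rogers_ramanujan_sum_tendsto:
  fixes p :: "'a::field fps"
  assumes p: "p $ 0 = 0"
    and w: "\<And>n i. int n \<le> i \<Longrightarrow> q ^ n dvd inv_poch p i - W"
  shows "(\<lambda>N. \<Sum>s=0..int N. p ^ nat (s\<^sup>2) * inv_poch p (int N - s) * inv_poch p s)
    \<longlonglongrightarrow> W * (\<Sum>n. p ^ (n\<^sup>2) * inv_poch p (int n))"
proof -
  define c where "c s = p ^ nat (s\<^sup>2) * inv_poch p s" for s
  have "nat \<bar>i\<bar> \<le> nat (i\<^sup>2)" for i :: int
  proof (cases "i = 0")
    case False
    then have "\<bar>i\<bar> ^ 1 \<le> \<bar>i\<bar> ^ 2" by (intro power_increasing) auto
    then show ?thesis by (intro nat_mono) simp
  qed simp
  then have c: "q ^ nat \<bar>i\<bar> dvd c i" for i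
    unfolding c_def by (intro dvd_mult2 fps_X_power_dvd_power p)
  have c_int: "c (int n) = p ^ (n\<^sup>2) * inv_poch p (int n)" for n
    by (simp add: c_def nat_power_eq)
  have "summable (\<lambda>n. c (int n))"
    using c by (intro fps_summableI) (metis abs_of_nat nat_int)
  then have "(\<lambda>N. \<Sum>n\<le>N. c (int n)) \<longlonglongrightarrow> (\<Sum>n. c (int n))"
    by (rule summable_LIMSEQ')
  also have "(\<lambda>N. \<Sum>n\<le>N. c (int n)) = (\<lambda>N. \<Sum>s=0..int N. c s)"
    by (intro ext sum.reindex_bij_witness[of _ nat int]) auto
  finally have S: "(\<lambda>N. \<Sum>s=0..int N. c s) \<longlonglongrightarrow> (\<Sum>n. c (int n))" .
  have "(\<lambda>N. \<Sum>s=0..int N. c s * (inv_poch p (int N - s) - W)) \<longlonglongrightarrow> 0"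
    by (rule fps_dominated_sum_tendsto_0[OF c]) (auto intro!: w)
  from tendsto_add[OF this tendsto_mult[OF tendsto_const S, of W]]
  have "(\<lambda>N. \<Sum>s=0..int N. c s * inv_poch p (int N - s)) \<longlonglongrightarrow> W * (\<Sum>n. c (int n))"
    by (simp add: sum_distrib_left sum.distrib[symmetric] algebra_simps)
  moreover have "nat ((int n)\<^sup>2) = n\<^sup>2" for n by (simp add: nat_power_eq)
  ultimately show ?thesis unfolding c_def by (simp add: ac_simps)
qed

lemma theta_partial_sums_tendsto:
  fixes c :: "int \<Rightarrow> 'a::field fps"
  assumes c: "\<And>i. q ^ nat \<bar>i\<bar> dvd c i"
  obtains T where "(\<lambda>N. \<Sum>m=-int N..int N. c m) \<longlonglongrightarrow> T"
proof -
  have "q ^ N dvd (\<Sum>m=-int (Suc N)..int (Suc N). c m) - (\<Sum>m=-int N..int N. c m)" for N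
  proof -
    have "{-int (Suc N)..int (Suc N)} = insert (int (Suc N)) (insert (- int (Suc N)) {-int N..int N})"
      by auto
    then have "(\<Sum>m=-int (Suc N)..int (Suc N). c m) - (\<Sum>m=-int N..int N. c m) = c (int (Suc N)) + c (- int (Suc N))"
      by simp
    moreover have "q ^ N dvd c (int (Suc N))" "q ^ N dvd c (- int (Suc N))"
      using dvd_trans[OF _ c[of "int (Suc N)"], of "q ^ N"] dvd_trans[OF _ c[of "- int (Suc N)"], of "q ^ N"]
      by (simp_all add: le_imp_power_dvd)
    ultimately show ?thesis by simp
  qed
  from fps_telescope_tendsto[of "\<lambda>N. \<Sum>m=-int N..int N. c m", OF this] that
  show ?thesis by blast
qed

text \<open>With \<open>W\<close> and \<open>V\<close> the reciprocals of the infinite products in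
  base \<open>p\<close> and \<open>p ^ 5\<close>, the two limits give \<open>S = W * T\<close> and
  \<open>B = V * T\<close> for the same theta series \<open>T\<close>.\<close>

theorem rogers_ramanujan:
  fixes p :: "'a::field fps"
  assumes p: "p $ 0 = 0"
  shows "(\<Sum>n. p ^ (n\<^sup>2) * inv_poch p (int n)) * (\<Prod>j. 1 - p ^ Suc j)
    = (\<Prod>j. 1 - p ^ (5 * Suc j)) * (\<Prod>j. (1 - p ^ (5 * j + 2)) * (1 - p ^ (5 * j + 3)))"
proof -
  define S where "S = (\<Sum>n. p ^ (n\<^sup>2) * inv_poch p (int n))"
  define c where "c = theta_term p 5 2"
  have c: "q ^ nat \<bar>i\<bar> dvd c i" for i
    unfolding c_def theta_term_def
    using theta_exp_ge[of 1 2 5 i] by (intro dvd_mult fps_X_power_dvd_power p) simp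
  obtain T where T: "(\<lambda>N. \<Sum>m=-int N..int N. c m) \<longlonglongrightarrow> T"
    by (rule theta_partial_sums_tendsto[OF c])
  obtain W where W: "\<forall>n i. int n \<le> i \<longrightarrow> q ^ n dvd inv_poch p i - W" "W * (\<Prod>j. 1 - p ^ Suc j) = 1"
    by (rule inv_poch_limit[OF p])
  have p5: "(p ^ 5) $ 0 = 0" using p by (simp add: fps_nth_0_power)
  obtain V where V: "(\<lambda>N. inv_poch (p ^ 5) (int N)) \<longlonglongrightarrow> V"
    "\<forall>n i. int n \<le> i \<longrightarrow> q ^ n dvd inv_poch (p ^ 5) i - V" "V * (\<Prod>j. 1 - (p ^ 5) ^ Suc j) = 1"
    by (rule inv_poch_limit[OF p5])
  have "one_mod_powers (\<lambda>j. (1 - p ^ (5 * j + 2)) * (1 - p ^ (5 * j + 3)))"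
    by (intro one_mod_powers_mult one_mod_powers_one_minus_power p) auto
  then obtain B where B: "(\<lambda>n. \<Prod>j<n. (1 - p ^ (5 * j + 2)) * (1 - p ^ (5 * j + 3))) \<longlonglongrightarrow> B"
    "(\<Prod>j. (1 - p ^ (5 * j + 2)) * (1 - p ^ (5 * j + 3))) = B"
    by (rule one_mod_powers_limit)

  have "(\<lambda>N. bailey_sum p c (int N)) \<longlonglongrightarrow> W * S"
    using rogers_ramanujan_sum_tendsto[OF p W(1)[rule_format]]
    by (simp add: finite_rogers_ramanujan[OF p] c_def S_def)
  moreover have "(\<lambda>N. bailey_sum p c (int N)) \<longlonglongrightarrow> W * W * T"
    by (rule bailey_sum_tendsto[OF W(1)[rule_format] c T])
  ultimately have "W * S = W * W * T"
    by (rule LIMSEQ_unique)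
  \<comment> \<open>\<open>W\<close> cancels because it is a unit.\<close>
  then have ST: "S = W * T" using W(2) by (auto simp: mult.assoc)

  \<comment> \<open>The same coefficients \<open>c\<close> satisfy the triple product recursion in
    base \<open>p ^ 5\<close>, with \<open>z = p ^ 2\<close> and \<open>y = p ^ 3\<close>.\<close>
  have fin: "bailey_sum (p ^ 5) c (int N)
    = (\<Prod>j<N. (1 - p ^ (5 * j + 2)) * (1 - p ^ (5 * j + 3))) * inv_poch (p ^ 5) (int (2 * N))" for N
  proof -
    have "theta_coeffs (p ^ 2) (p ^ 3) c"
      using theta_coeffs_theta_term[of 2 5 p] by (simp add: c_def)
    moreover have e: "p ^ 2 * p ^ 3 = p ^ 5" by (simp flip: power_add)
    ultimately have "bailey_sum (p ^ 5) c (int N)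
      = (\<Prod>j<N. (1 - p ^ 2 * (p ^ 5) ^ j) * (1 - p ^ 3 * (p ^ 5) ^ j)) * inv_poch (p ^ 5) (2 * int N)"
      using finite_jacobi_triple_product[of "p ^ 2" "p ^ 3" c N] p5 by simp
    moreover have "p ^ 2 * (p ^ 5) ^ j = p ^ (5 * j + 2)" "p ^ 3 * (p ^ 5) ^ j = p ^ (5 * j + 3)" for j
      by (simp_all only: power_mult[symmetric] power_add[symmetric] add.commute)
    ultimately show ?thesis by simp
  qed
  have "(\<lambda>N. inv_poch (p ^ 5) (int (2 * N))) \<longlonglongrightarrow> V"
    using LIMSEQ_subseq_LIMSEQ[OF V(1), of "\<lambda>N. 2 * N"] by (simp add: strict_mono_def o_def)
  from tendsto_mult[OF B(1) this] have "(\<lambda>N. bailey_sum (p ^ 5) c (int N)) \<longlonglongrightarrow> B * V"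
    by (simp only: fin)
  moreover have "(\<lambda>N. bailey_sum (p ^ 5) c (int N)) \<longlonglongrightarrow> V * V * T"
    by (rule bailey_sum_tendsto[OF V(2)[rule_format] c T])
  ultimately have "B * V = V * V * T"
    by (rule LIMSEQ_unique)
  then have BT: "B = V * T" using V(3) by (auto simp: mult.assoc mult.commute[of B])

  have "S * (\<Prod>j. 1 - p ^ Suc j) = T"
    unfolding ST mult.commute[of W T] mult.assoc W(2) by simp
  also have "T = (\<Prod>j. 1 - (p ^ 5) ^ Suc j) * B"
    unfolding BT mult.assoc[symmetric] mult.commute[of _ V] V(3) by simp
  finally show ?thesis
    unfolding S_def B(2) by (simp only: power_mult)
qed

section \<open>Residues modulo 5 and the product form of the identity\<close>

lemma prodinf_split_mod_5:
  fixes p :: "'a::field fps"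
  assumes p: "p $ 0 = 0"
  shows "(\<Prod>j. 1 - p ^ Suc j)
    = (\<Prod>j. (1 - p ^ (5 * j + 1)) * (1 - p ^ (5 * j + 4)))
      * ((\<Prod>j. 1 - p ^ (5 * Suc j)) * (\<Prod>j. (1 - p ^ (5 * j + 2)) * (1 - p ^ (5 * j + 3))))"
proof -
  define a where "a j = (1 - p ^ (5 * j + 1)) * (1 - p ^ (5 * j + 4))" for j
  define b where "b j = (1 - p ^ (5 * j + 2)) * (1 - p ^ (5 * j + 3))" for j
  define e where "e j = 1 - p ^ (5 * Suc j)" for j
  have a: "one_mod_powers a" and b: "one_mod_powers b" and e: "one_mod_powers e"
    unfolding a_def b_def e_def by (intro one_mod_powers_mult one_mod_powers_one_minus_power p; simp)+
  have u: "one_mod_powers (\<lambda>j. 1 - p ^ Suc j)"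
    by (intro one_mod_powers_one_minus_power p) simp
  obtain L where L: "(\<lambda>N. \<Prod>j<N. 1 - p ^ Suc j) \<longlonglongrightarrow> L" "(\<Prod>j. 1 - p ^ Suc j) = L"
    by (rule one_mod_powers_limit[OF u])
  have eb: "one_mod_powers (\<lambda>j. e j * b j)" using e b by (rule one_mod_powers_mult)
  have aeb: "one_mod_powers (\<lambda>j. a j * (e j * b j))" using a eb by (rule one_mod_powers_mult)
  obtain M where M: "(\<lambda>N. \<Prod>j<N. a j * (e j * b j)) \<longlonglongrightarrow> M" "(\<Prod>j. a j * (e j * b j)) = M"
    by (rule one_mod_powers_limit[OF aeb])
  \<comment> \<open>Partial products of length \<open>5 * N\<close> regroup exactly, and this
    subsequence has the same limit.\<close>
  have "(\<Prod>j<5 * N. 1 - p ^ Suc j) = (\<Prod>j<N. a j * (e j * b j))" for N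
  proof (induction N)
    case (Suc N)
    have five: "5 * N + 5 = 5 * Suc N" by simp
    have "5 * Suc N = Suc (Suc (Suc (Suc (Suc (5 * N)))))" by simp
    then have "(\<Prod>j<5 * Suc N. 1 - p ^ Suc j) = (\<Prod>j<5 * N. 1 - p ^ Suc j)
      * (1 - p ^ (5 * N + 1)) * (1 - p ^ (5 * N + 2)) * (1 - p ^ (5 * N + 3)) * (1 - p ^ (5 * N + 4)) * (1 - p ^ (5 * N + 5))"
      by (simp only: prod.lessThan_Suc) (simp add: eval_nat_numeral)
    also have "\<dots> = (\<Prod>j<Suc N. a j * (e j * b j))"
      unfolding five Suc.IH prod.lessThan_Suc by (simp only: a_def b_def e_def ac_simps mult_Suc_right)
    finally show ?case .
  qed simp
  moreover have "(\<lambda>N. \<Prod>j<5 * N. 1 - p ^ Suc j) \<longlonglongrightarrow> L"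
    using LIMSEQ_subseq_LIMSEQ[OF L(1), of "\<lambda>N. 5 * N"] by (simp add: strict_mono_def o_def)
  ultimately have "L = M" using LIMSEQ_unique M(1) by simp
  then have "(\<Prod>j. 1 - p ^ Suc j) = prodinf a * (prodinf e * prodinf b)"
    using L(2) M(2) prodinf_one_mod_powers_mult[OF a eb] prodinf_one_mod_powers_mult[OF e b] by simp
  then show ?thesis unfolding a_def b_def e_def .
qed

text \<open>The residues 0, 2 and 3 modulo 5 occur on both sides of \<open>rogers_ramanujan\<close>.
  Their product \<open>EB\<close> has constant coefficient 1 and cancels, leaving the residues 1 and
  4.\<close>

theorem rogers_ramanujan_product:
  fixes p :: "'a::field fps"
  assumes p: "p $ 0 = 0"
  shows "(\<Sum>n. p ^ (n\<^sup>2) * inv_poch p (int n))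
    = (\<Prod>j. inverse ((1 - p ^ (5 * j + 1)) * (1 - p ^ (5 * j + 4))))"
proof -
  define S where "S = (\<Sum>n. p ^ (n\<^sup>2) * inv_poch p (int n))"
  define a where "a j = (1 - p ^ (5 * j + 1)) * (1 - p ^ (5 * j + 4))" for j
  define EB where "EB = (\<Prod>j. 1 - p ^ (5 * Suc j)) * (\<Prod>j. (1 - p ^ (5 * j + 2)) * (1 - p ^ (5 * j + 3)))"
  have a: "one_mod_powers a"
    unfolding a_def by (intro one_mod_powers_mult one_mod_powers_one_minus_power p) auto
  have e: "one_mod_powers (\<lambda>j. 1 - p ^ (5 * Suc j))"
    and b: "one_mod_powers (\<lambda>j. (1 - p ^ (5 * j + 2)) * (1 - p ^ (5 * j + 3)))"
    by (intro one_mod_powers_mult one_mod_powers_one_minus_power p; simp)+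
  have "EB $ 0 = 1"
    using prodinf_one_mod_powers_nth_0[OF e] prodinf_one_mod_powers_nth_0[OF b] by (simp only: EB_def fps_mult_nth_0 mult_1)
  then have "EB \<noteq> 0" by auto
  moreover have "S * (prodinf a * EB) = EB"
    using rogers_ramanujan[OF p] unfolding prodinf_split_mod_5[OF p] S_def a_def EB_def .
  ultimately have "S * prodinf a = 1"
    by (simp add: mult.assoc[symmetric])
  then have "S * prodinf a * (\<Prod>j. inverse (a j)) = (\<Prod>j. inverse (a j))" by simp
  then have "S = (\<Prod>j. inverse (a j))"
    using prodinf_one_mod_powers_inverse[OF a] by (simp add: mult.assoc mult.commute[of "prodinf a"])
  then show ?thesis unfolding S_def a_def .
qed

section \<open>Reduction of the four expressions to the variable \<open>p = q ^ k\<close>\<close>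

lemma sum_exponent_eq_square: "k * n + 2 * k * (\<Sum>i=1..<n. i) = k * n\<^sup>2" for k n :: nat
proof -
  have "n + 2 * (\<Sum>i=1..<n. i) = n\<^sup>2"
  proof (induction n)
    case (Suc n)
    then show ?case by (cases "n = 0") (auto simp: power2_eq_square)
  qed simp
  then have "k * (n + 2 * (\<Sum>i=1..<n. i)) = k * n\<^sup>2" by simp
  then show ?thesis by (simp add: algebra_simps)
qed

lemma geometric_factor:
  assumes "m > 0"
  shows "(\<Sum>i<k. q ^ (i * m)) = (1 - q ^ (m * k)) / (1 - q ^ m :: 'a::field fps)"
proof -
  have "1 - q ^ m \<noteq> (0 :: 'a fps)" using assms by (intro one_minus_power_neq_0) auto
  moreover have "(1 - q ^ m) * (\<Sum>i<k. q ^ (i * m)) = (1 - q ^ (m * k) :: 'a fps)"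
    using one_diff_power_eq[of "q ^ m :: 'a fps" k] by (simp add: power_mult[symmetric] mult.commute)
  ultimately show ?thesis by (metis nonzero_mult_div_cancel_left)
qed

theorem mainTheorem4:
  fixes k :: nat
  assumes "k \<ge> 1"
  shows
    "(\<forall>n::nat. convergent_prod (\<lambda>j. (\<Sum>i<k. q ^ (i * (n + 1 + j))) :: 'a::field fps))
   \<and> summable (\<lambda>n. q ^ (k * n + 2 * k * (\<Sum>i=1..<n. i)) / (\<Prod>j=1..n. 1 - q ^ j)
        * (\<Prod>j. \<Sum>i<k. q ^ (i * (n + 1 + j))) :: 'a fps)
   \<and> convergent_prod (\<lambda>j. (1 - q ^ (Suc j * k)) / (1 - q ^ Suc j) :: 'a fps)
   \<and> summable (\<lambda>n. q ^ (k * n\<^sup>2) / (\<Prod>j=1..n. 1 - q ^ (j * k)) :: 'a fps)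
   \<and> convergent_prod (\<lambda>n. 1 / ((1 - q ^ (k * (5 * Suc n - 4))) * (1 - q ^ (k * (5 * Suc n - 1)))) :: 'a fps)
   \<and> convergent_prod (\<lambda>j. (1 - q ^ (5 * k * Suc j)) * (1 - q ^ (k * (5 * Suc j - 2)))
        * (1 - q ^ (k * (5 * Suc j - 3))) / (1 - q ^ Suc j) :: 'a fps)
   \<and> (\<Sum>n. q ^ (k * n + 2 * k * (\<Sum>i=1..<n. i)) / (\<Prod>j=1..n. 1 - q ^ j)
        * (\<Prod>j. \<Sum>i<k. q ^ (i * (n + 1 + j))) :: 'a fps)
     = (\<Prod>j. (1 - q ^ (Suc j * k)) / (1 - q ^ Suc j))
        * (\<Sum>n. q ^ (k * n\<^sup>2) / (\<Prod>j=1..n. 1 - q ^ (j * k)))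
   \<and> (\<Prod>j. (1 - q ^ (Suc j * k)) / (1 - q ^ Suc j))
        * (\<Sum>n. q ^ (k * n\<^sup>2) / (\<Prod>j=1..n. 1 - q ^ (j * k)) :: 'a fps)
     = (\<Prod>j. (1 - q ^ (Suc j * k)) / (1 - q ^ Suc j))
        * (\<Prod>n. 1 / ((1 - q ^ (k * (5 * Suc n - 4))) * (1 - q ^ (k * (5 * Suc n - 1)))))
   \<and> (\<Prod>j. (1 - q ^ (Suc j * k)) / (1 - q ^ Suc j))
        * (\<Prod>n. 1 / ((1 - q ^ (k * (5 * Suc n - 4))) * (1 - q ^ (k * (5 * Suc n - 1)))) :: 'a fps)
     = (\<Prod>j. (1 - q ^ (5 * k * Suc j)) * (1 - q ^ (k * (5 * Suc j - 2)))
        * (1 - q ^ (k * (5 * Suc j - 3))) / (1 - q ^ Suc j))"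
proof -
  define p :: "'a fps" where "p = q ^ k"
  define u :: "nat \<Rightarrow> 'a fps" where "u j = 1 - q ^ Suc j" for j
  define v where "v j = 1 - p ^ Suc j" for j
  define a where "a j = (1 - p ^ (5 * j + 1)) * (1 - p ^ (5 * j + 4))" for j
  define b where "b j = (1 - p ^ (5 * j + 2)) * (1 - p ^ (5 * j + 3))" for j
  define e where "e j = 1 - p ^ (5 * Suc j)" for j
  define g :: "nat \<Rightarrow> 'a fps" where "g j = (\<Sum>i<k. q ^ (i * Suc j))" for j
  define t where "t n = p ^ (n\<^sup>2) * inv_poch p (int n)" for n
  \<comment> \<open>This is where \<open>k \<ge> 1\<close> enters: for \<open>k = 0\<close> the
    series \<open>p\<close> would be 1.\<close>
  have p0: "p $ 0 = 0" using assms by (simp add: p_def fps_nth_0_power)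
  have p_pow: "p ^ i = q ^ (k * i)" "p ^ i = q ^ (i * k)" for i
    by (simp_all add: p_def mult.commute flip: power_mult)
  have u: "one_mod_powers u"
    unfolding u_def by (intro one_mod_powers_one_minus_power) auto
  have v: "one_mod_powers v" and a: "one_mod_powers a" and b: "one_mod_powers b" and e: "one_mod_powers e"
    unfolding v_def a_def b_def e_def
    by (intro one_mod_powers_mult one_mod_powers_one_minus_power p0; simp)+
  have eb: "one_mod_powers (\<lambda>j. e j * b j)" using e b by (rule one_mod_powers_mult)
  have g_eq: "g j = v j / u j" for j
    using geometric_factor[OF zero_less_Suc] unfolding g_def u_def v_def p_pow(2) .
  have g: "one_mod_powers g"
    unfolding g_eq[abs_def] using v u by (rule one_mod_powers_divide)

  \<comment> \<open>The next equations bring the factors and summands of the statement into the form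
    \<open>g\<close>, \<open>t\<close>, \<open>a\<close>, \<open>b\<close>, \<open>e\<close>,
    \<open>u\<close>, to which \<open>one_mod_powers\<close> and the identities in \<open>p\<close>
    apply.\<close>
  have D_fun: "(\<lambda>j. (1 - q ^ (Suc j * k)) / (1 - q ^ Suc j)) = g"
    by (rule ext) (simp only: g_eq u_def v_def p_pow(2))
  have g_shift: "(\<lambda>j. \<Sum>i<k. q ^ (i * (n + 1 + j))) = (\<lambda>j. g (n + j))" for n
    by (simp add: g_def fun_eq_iff)
  have t_fun: "(\<lambda>n. q ^ (k * n\<^sup>2) / (\<Prod>j=1..n. 1 - q ^ (j * k))) = t"
  proof
    fix n
    have "(\<Prod>j=1..n. 1 - p ^ j) $ 0 \<noteq> 0"
      using p0 by (simp add: fps_nth_0_prod fps_nth_0_power)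
    from fps_divide_unit[OF this] show "q ^ (k * n\<^sup>2) / (\<Prod>j=1..n. 1 - q ^ (j * k)) = t n"
      by (simp only: t_def inv_poch_int p_pow(2)[symmetric] p_pow(1)[symmetric])
  qed
  have a_fun: "(\<lambda>n. 1 / ((1 - q ^ (k * (5 * Suc n - 4))) * (1 - q ^ (k * (5 * Suc n - 1))))) = (\<lambda>n. inverse (a n))"
  proof
    fix n
    \<comment> \<open>With the index shifted by \<open>Suc\<close>, the natural subtractions do not
      truncate.\<close>
    have "5 * Suc n - 4 = 5 * n + 1" "5 * Suc n - 1 = 5 * n + 4" by simp_all
    then have "1 / ((1 - q ^ (k * (5 * Suc n - 4))) * (1 - q ^ (k * (5 * Suc n - 1)))) = 1 / a n"
      by (simp only: a_def p_pow(1))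
    then show "1 / ((1 - q ^ (k * (5 * Suc n - 4))) * (1 - q ^ (k * (5 * Suc n - 1)))) = inverse (a n)"
      using one_mod_powers_nth_0[OF a, of n] by (simp add: fps_divide_unit)
  qed
  have eb_fun: "(\<lambda>j. (1 - q ^ (5 * k * Suc j)) * (1 - q ^ (k * (5 * Suc j - 2)))
        * (1 - q ^ (k * (5 * Suc j - 3))) / (1 - q ^ Suc j)) = (\<lambda>j. e j * b j / u j)"
  proof
    fix j
    have "5 * Suc j - 2 = 5 * j + 3" "5 * Suc j - 3 = 5 * j + 2" "5 * k * Suc j = k * (5 * Suc j)"
      by (simp_all only: ac_simps) simp_all
    then show "(1 - q ^ (5 * k * Suc j)) * (1 - q ^ (k * (5 * Suc j - 2)))
        * (1 - q ^ (k * (5 * Suc j - 3))) / (1 - q ^ Suc j) = e j * b j / u j"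
      by (simp only: e_def b_def u_def p_pow(1) mult.assoc mult.commute[of "1 - q ^ (k * (5 * j + 3))"])
  qed
  \<comment> \<open>The first \<open>n\<close> factors of \<open>prodinf g\<close> convert the
    denominator in \<open>q\<close> into the one in \<open>p\<close>, since
    \<open>v j = u j * g j\<close>; the remaining factors are the tail product.\<close>
  have first_summand: "q ^ (k * n + 2 * k * (\<Sum>i=1..<n. i)) / (\<Prod>j=1..n. 1 - q ^ j)
        * (\<Prod>j. \<Sum>i<k. q ^ (i * (n + 1 + j))) = prodinf g * t n" for n
  proof -
    define F :: "'a fps" where "F = (\<Prod>j<n. u j)"
    define G where "G = (\<Prod>j<n. g j)"
    have F: "(\<Prod>j=1..n. 1 - q ^ j) = F"
      unfolding F_def u_def by (rule prod.reindex_bij_witness[of _ Suc "\<lambda>j. j - 1"]) auto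
    have "(\<Prod>j=1..n. 1 - p ^ j) = (\<Prod>j<n. v j)"
      unfolding v_def by (rule prod.reindex_bij_witness[of _ Suc "\<lambda>j. j - 1"]) auto
    also have "\<dots> = F * G"
      unfolding F_def G_def prod.distrib[symmetric]
    proof (intro prod.cong refl)
      fix j
      show "v j = u j * g j"
        using one_mod_powers_nth_0[OF u, of j] unfolding g_eq
        by (simp add: fps_divide_unit mult.left_commute[of "u j"] inverse_mult_eq_1')
    qed
    finally have FG: "inv_poch p (int n) = inverse F * inverse G"
      by (simp add: inv_poch_int fps_inverse_mult)
    have F0: "F $ 0 \<noteq> 0" and G0: "G $ 0 \<noteq> 0"
      by (simp_all add: F_def G_def fps_nth_0_prod one_mod_powers_nth_0[OF u] one_mod_powers_nth_0[OF g])
    have "prodinf g * t n = G * inverse G * (p ^ (n\<^sup>2) * inverse F * (\<Prod>j. g (n + j)))"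
      unfolding prodinf_one_mod_powers_split[OF g, of n] t_def FG G_def[symmetric] by (simp only: ac_simps)
    also have "G * inverse G = 1" using G0 by (rule inverse_mult_eq_1')
    finally show ?thesis
      by (simp only: g_shift sum_exponent_eq_square F p_pow(1) fps_divide_unit[OF F0] mult_1)
  qed

  have t_summable: "summable t"
  proof (rule fps_summableI)
    fix n :: nat
    have "n \<le> n\<^sup>2" by (cases n) (simp_all add: power2_eq_square)
    then show "q ^ n dvd t n" unfolding t_def by (intro dvd_mult2 fps_X_power_dvd_power p0)
  qed
  have conv: "convergent_prod w" if "one_mod_powers w" for w :: "nat \<Rightarrow> 'a fps"
    by (rule one_mod_powers_limit[OF that])
  have S: "suminf t = (\<Prod>j. inverse (a j))"
    using rogers_ramanujan_product[OF p0] unfolding t_def a_def .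
  \<comment> \<open>Both sides are compared after multiplication by \<open>prodinf u\<close>, which
    is nonzero; the inverse of \<open>prodinf a\<close> then removes the residues 1 and 4 from
    \<open>prodinf v\<close>.\<close>
  have last: "prodinf g * (\<Prod>j. inverse (a j)) = (\<Prod>j. e j * b j / u j)"
  proof -
    have "prodinf g * (\<Prod>j. inverse (a j)) * prodinf u = prodinf v * (\<Prod>j. inverse (a j))"
      using prodinf_one_mod_powers_divide[OF v u] by (simp add: g_eq[abs_def] ac_simps)
    also have "\<dots> = (\<Prod>j. inverse (a j)) * prodinf a * (prodinf e * prodinf b)"
    proof -
      have "prodinf v = prodinf a * (prodinf e * prodinf b)"
        using prodinf_split_mod_5[OF p0] unfolding v_def a_def b_def e_def .
      then show ?thesis by (simp only: ac_simps)
    qed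
    also have "\<dots> = (\<Prod>j. e j * b j)"
      by (simp add: prodinf_one_mod_powers_inverse[OF a] prodinf_one_mod_powers_mult[OF e b])
    also have "\<dots> = (\<Prod>j. e j * b j / u j) * prodinf u"
      by (rule prodinf_one_mod_powers_divide[OF eb u, symmetric])
    finally show ?thesis
      using prodinf_one_mod_powers_nth_0[OF u] by auto
  qed
  \<comment> \<open>Every summand of the first series is now \<open>prodinf g * t n\<close>, so the
    constant factor can be pulled out.\<close>
  show ?thesis
    unfolding first_summand
    unfolding g_shift D_fun t_fun a_fun eb_fun S last
    using fps_suminf_mult[OF t_summable, of "prodinf g"] S last t_summable
    by (intro conjI allI conv one_mod_powers_shift one_mod_powers_inverse one_mod_powers_divide
        g a eb u) auto
qed

end
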